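(* Let $D$ be a c.p.o. endowed with the Scott topology. Then $\pi_n(D,d)=\{[c^n(d)]\}$ for all $d\in D$ and all $n\ge 0$.
   Context: A c.p.o. is a partially ordered set $(D,\sqsubseteq)$ with a least element $\perp$ such that every directed subset $X\subseteq D$ has a least upper bound $\bigsqcup X$; a subset $X$ is directed if it is non-empty and any $a,b\in X$ have an upper bound $c\in X$. The Scott topology on $D$ consists of $\emptyset$ and all $A\subseteq D$ that are final ($a\in A$ and $a\sqsubseteq b$ imply $b\in A$) and inaccessible by directedness ($\bigsqcup X\in A$ implies $X\cap A\ne\emptyset$ for every directed $X\subseteq D$). For a topological space $D$ and $d\in D$, a closed $n$-path at $d$ is a continuous map $[0,1]^n\to D$ sending $\partial([0,1]^n)$ to $d$; $\pi_n(D,d)$ is the set of homotopy classes of closed $n$-paths at $d$, homotopies being required to be constantly equal to $d$ on $\partial([0,1]^n)$ (for $n=0$, where $[0,1]^0$ is a point with empty boundary, this is the set of path components of $D$). $c^n(d)$ is the constant closed $n$-path at $d$ and $[\,\cdot\,]$ denotes homotopy class. *)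

theory Defs
  imports "HOL-Analysis.Analysis"
begin

section \<open>C.p.o.s and the Scott topology\<close>

text \<open>A poset is a carrier set \<open>D\<close> together with a relation \<open>r\<close>, where \<open>(a, b) \<in> r\<close> means
  \<open>a \<sqsubseteq> b\<close>. C.p.o.s here are directed-complete and pointed, unlike the library class
  \<open>ccpo\<close>, which is based on chains.\<close>

definition directed_subset :: "'a set \<Rightarrow> 'a rel \<Rightarrow> 'a set \<Rightarrow> bool" where
  "directed_subset D r X \<longleftrightarrow>
     X \<subseteq> D \<and> X \<noteq> {} \<and> (\<forall>a\<in>X. \<forall>b\<in>X. \<exists>c\<in>X. (a, c) \<in> r \<and> (b, c) \<in> r)"

definition is_lub_of :: "'a set \<Rightarrow> 'a rel \<Rightarrow> 'a set \<Rightarrow> 'a \<Rightarrow> bool" where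
  "is_lub_of D r X s \<longleftrightarrow>
     s \<in> D \<and> (\<forall>x\<in>X. (x, s) \<in> r) \<and> (\<forall>u\<in>D. (\<forall>x\<in>X. (x, u) \<in> r) \<longrightarrow> (s, u) \<in> r)"

definition cpo :: "'a set \<Rightarrow> 'a rel \<Rightarrow> bool" where
  "cpo D r \<longleftrightarrow>
     partial_order_on D r \<and>
     (\<exists>b\<in>D. \<forall>x\<in>D. (b, x) \<in> r) \<and>
     (\<forall>X. directed_subset D r X \<longrightarrow> (\<exists>s. is_lub_of D r X s))"

definition scott_open :: "'a set \<Rightarrow> 'a rel \<Rightarrow> 'a set \<Rightarrow> bool" where
  "scott_open D r A \<longleftrightarrow>
     A \<subseteq> D \<and>
     (\<forall>a\<in>A. \<forall>b\<in>D. (a, b) \<in> r \<longrightarrow> b \<in> A) \<and>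
     (\<forall>X s. directed_subset D r X \<and> is_lub_of D r X s \<and> s \<in> A \<longrightarrow> X \<inter> A \<noteq> {})"

definition scott_topology :: "'a set \<Rightarrow> 'a rel \<Rightarrow> 'a topology" where
  "scott_topology D r = topology (scott_open D r)"

lemma istopology_scott_open: "istopology (scott_open D r)"
  unfolding istopology_def
proof (intro conjI allI impI)
  fix A B assume A: "scott_open D r A" and B: "scott_open D r B"
  show "scott_open D r (A \<inter> B)"
    unfolding scott_open_def
  proof (intro conjI allI impI)
    show "A \<inter> B \<subseteq> D" using A by (auto simp: scott_open_def)
    show "\<forall>a\<in>A \<inter> B. \<forall>b\<in>D. (a, b) \<in> r \<longrightarrow> b \<in> A \<inter> B"
      using A B unfolding scott_open_def by blast
  next
    fix X s assume X: "directed_subset D r X \<and> is_lub_of D r X s \<and> s \<in> A \<inter> B"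
    have "X \<inter> A \<noteq> {}" "X \<inter> B \<noteq> {}"
      using A B X unfolding scott_open_def by blast+
    then obtain a b where ab: "a \<in> X" "a \<in> A" "b \<in> X" "b \<in> B" by blast
    with X obtain c where c: "c \<in> X" "(a, c) \<in> r" "(b, c) \<in> r" "c \<in> D"
      unfolding directed_subset_def by blast
    then have "c \<in> A \<inter> B" using A B ab unfolding scott_open_def by blast
    with c show "X \<inter> (A \<inter> B) \<noteq> {}" by blast
  qed
next
  fix K assume K: "\<forall>A\<in>K. scott_open D r A"
  show "scott_open D r (\<Union>K)"
    unfolding scott_open_def
  proof (intro conjI allI impI)
    show "\<Union>K \<subseteq> D" using K by (auto simp: scott_open_def)
    show "\<forall>a\<in>\<Union>K. \<forall>b\<in>D. (a, b) \<in> r \<longrightarrow> b \<in> \<Union>K"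
    proof (intro ballI impI)
      fix a b assume "a \<in> \<Union>K" "b \<in> D" "(a, b) \<in> r"
      then obtain A where "A \<in> K" "a \<in> A" by blast
      with K \<open>b \<in> D\<close> \<open>(a, b) \<in> r\<close> have "b \<in> A" by (simp add: scott_open_def)
      with \<open>A \<in> K\<close> show "b \<in> \<Union>K" by (rule UnionI)
    qed
  next
    fix X s assume X: "directed_subset D r X \<and> is_lub_of D r X s \<and> s \<in> \<Union>K"
    then obtain A where A: "A \<in> K" "s \<in> A" by blast
    from K A have "scott_open D r A" by simp
    with X A have "X \<inter> A \<noteq> {}" unfolding scott_open_def by blast
    with A show "X \<inter> \<Union>K \<noteq> {}" by auto
  qed
qed

lemma openin_scott_topology [simp]: "openin (scott_topology D r) A \<longleftrightarrow> scott_open D r A"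
  by (simp add: scott_topology_def topology_inverse' istopology_scott_open)

lemma topspace_scott_topology [simp]: "topspace (scott_topology D r) = D"
proof
  show "topspace (scott_topology D r) \<subseteq> D"
    unfolding topspace_def by (auto simp: scott_open_def)
  have "openin (scott_topology D r) D"
    by (auto simp: scott_open_def directed_subset_def)
  then show "D \<subseteq> topspace (scott_topology D r)" by (rule openin_subset)
qed

section \<open>Homotopy classes of closed n-paths\<close>

text \<open>The cube \<open>[0,1]\<^sup>n\<close> consists of functions on \<open>{..<n}\<close>, extended by
  \<open>undefined\<close>; for \<open>n = 0\<close> it is a single point, with empty boundary.\<close>

definition unit_cube :: "nat \<Rightarrow> (nat \<Rightarrow> real) topology" where
  "unit_cube n = product_topology (\<lambda>_. top_of_set {0..1}) {..<n}"

definition cube_boundary :: "nat \<Rightarrow> (nat \<Rightarrow> real) set" where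
  "cube_boundary n = {x \<in> topspace (unit_cube n). \<exists>i<n. x i = 0 \<or> x i = 1}"

text \<open>Paths are required to be extensional, so that equality of paths is equality as maps
  on the cube.\<close>

definition closed_paths :: "nat \<Rightarrow> 'a topology \<Rightarrow> 'a \<Rightarrow> ((nat \<Rightarrow> real) \<Rightarrow> 'a) set" where
  "closed_paths n X d =
     {p. p \<in> extensional (topspace (unit_cube n)) \<and>
         continuous_map (unit_cube n) X p \<and> (\<forall>x\<in>cube_boundary n. p x = d)}"

definition path_homotopy :: "nat \<Rightarrow> 'a topology \<Rightarrow> 'a \<Rightarrow> ((nat \<Rightarrow> real) \<Rightarrow> 'a) rel" where
  "path_homotopy n X d =
     {(p, q). p \<in> closed_paths n X d \<and> q \<in> closed_paths n X d \<and>
        homotopic_with (\<lambda>h. \<forall>x\<in>cube_boundary n. h x = d) (unit_cube n) X p q}"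

definition homotopy_class ::
    "nat \<Rightarrow> 'a topology \<Rightarrow> 'a \<Rightarrow> ((nat \<Rightarrow> real) \<Rightarrow> 'a) \<Rightarrow> ((nat \<Rightarrow> real) \<Rightarrow> 'a) set" where
  "homotopy_class n X d p = path_homotopy n X d `` {p}"

definition homotopy_classes ::
    "nat \<Rightarrow> 'a topology \<Rightarrow> 'a \<Rightarrow> ((nat \<Rightarrow> real) \<Rightarrow> 'a) set set" where
  "homotopy_classes n X d = closed_paths n X d // path_homotopy n X d"

definition const_path :: "nat \<Rightarrow> 'a \<Rightarrow> (nat \<Rightarrow> real) \<Rightarrow> 'a" where
  "const_path n d = (\<lambda>x\<in>topspace (unit_cube n). d)"

end

theory Submission
  imports Defs
begin

text \<open>If \<open>f \<sqsubseteq> g\<close> pointwise, the map that is \<open>f\<close> at time 0 and \<open>g\<close> at all positive times is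
  continuous, because Scott open sets are final. So comparable maps are homotopic, relative to
  every set on which they agree. A closed path \<open>p\<close> at \<open>d\<close> is first squeezed into the inner cube
  \<open>[1/3,2/3]\<^sup>n\<close>, so that it is constantly \<open>d\<close> on a collar of the boundary. The map that is \<open>d\<close> on
  the open collar and \<open>\<bottom>\<close> elsewhere is continuous, and it lies below both the squeezed path and
  the constant path.\<close>

lemma homotopic_with_scott_le:
  assumes f: "continuous_map X (scott_topology D r) f"
    and g: "continuous_map X (scott_topology D r) g"
    and le: "\<And>x. x \<in> topspace X \<Longrightarrow> (f x, g x) \<in> r"
    and P: "P f" "P g"
  shows "homotopic_with P X (scott_topology D r) f g"
proof -
  let ?I = "top_of_set {0..1::real}"
  define h where "h = (\<lambda>(t::real, x). if t = 0 then f x else g x)"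
  have "continuous_map (prod_topology ?I X) (scott_topology D r) h"
    unfolding continuous_map_def
  proof (intro conjI allI impI)
    show "h \<in> topspace (prod_topology ?I X) \<rightarrow> topspace (scott_topology D r)"
      using f g by (auto simp: h_def continuous_map_def Pi_iff)
  next
    fix U assume U: "openin (scott_topology D r) U"
    let ?A = "{x \<in> topspace X. f x \<in> U}" and ?B = "{x \<in> topspace X. g x \<in> U}"
    have up: "g x \<in> U" if "f x \<in> U" "x \<in> topspace X" for x
    proof -
      have "g x \<in> D" using g that by (auto simp: continuous_map_def Pi_iff)
      then show ?thesis using U le[of x] that by (auto simp: scott_open_def)
    qed
    \<comment> \<open>By \<open>up\<close>, \<open>?A\<close> lies inside \<open>?B\<close>, so the
      slice at time 0 may be thickened to all times. This writes the preimage as a union of two open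
      rectangles.\<close>
    have "{z \<in> topspace (prod_topology ?I X). h z \<in> U} = {0..1} \<times> ?A \<union> {0<..1} \<times> ?B"
      by (auto simp: h_def up split: if_splits)
    moreover have "openin ?I {0<..1}"
      by (auto simp: openin_open intro!: exI[of _ "{0<..}"])
    ultimately show "openin (prod_topology ?I X) {z \<in> topspace (prod_topology ?I X). h z \<in> U}"
      using U openin_continuous_map_preimage[OF f U] openin_continuous_map_preimage[OF g U]
      by (auto intro!: openin_Un simp: openin_prod_Times_iff openin_subtopology_self)
  qed
  \<comment> \<open>Every time slice of \<open>h\<close> is \<open>f\<close> or \<open>g\<close>
    itself, so \<open>P\<close> at the two ends suffices.\<close>
  moreover have "P (\<lambda>x. h (t, x))" for t
    using P by (cases "t = 0") (simp_all add: h_def)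
  ultimately show ?thesis
    unfolding homotopic_with_def by (intro exI[of _ h]) (simp add: h_def)
qed

lemma equiv_path_homotopy: "equiv (closed_paths n X d) (path_homotopy n X d)"
proof (rule equivI)
  show "path_homotopy n X d \<subseteq> closed_paths n X d \<times> closed_paths n X d"
    by (auto simp: path_homotopy_def)
  show "refl_on (closed_paths n X d) (path_homotopy n X d)"
    by (auto simp: refl_on_def path_homotopy_def closed_paths_def)
  show "sym (path_homotopy n X d)"
    by (auto simp: sym_def path_homotopy_def homotopic_with_sym)
  show "trans (path_homotopy n X d)"
    by (auto simp: trans_def path_homotopy_def intro: homotopic_with_trans)
qed

lemma cube_boundary_subset: "cube_boundary n \<subseteq> topspace (unit_cube n)"
  by (auto simp: cube_boundary_def)

lemma const_path_in_closed_paths: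
  assumes "d \<in> topspace X"
  shows "const_path n d \<in> closed_paths n X d"
  using assms cube_boundary_subset[of n]
  by (auto simp: const_path_def closed_paths_def intro: continuous_map_eq[of _ _ "\<lambda>_. d"])

text \<open>Affine with slope \<open>1 + 2 * t\<close> about the midpoint of the interval, then clamped to the interval:
  it is the identity for \<open>t = 0\<close> and sends the two outer thirds to the endpoints for \<open>t = 1\<close>.\<close>

definition stretch :: "real \<Rightarrow> real \<Rightarrow> real" where
  "stretch t u = max 0 (min 1 (u + t * (2 * u - 1)))"

definition cube_stretch :: "nat \<Rightarrow> real \<Rightarrow> (nat \<Rightarrow> real) \<Rightarrow> nat \<Rightarrow> real" where
  "cube_stretch n t x = (\<lambda>i\<in>{..<n}. stretch t (x i))"

lemma stretch_0: "0 \<le> u \<Longrightarrow> u \<le> 1 \<Longrightarrow> stretch 0 u = u"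
  by (simp add: stretch_def)

lemma stretch_endpoints: "0 \<le> t \<Longrightarrow> stretch t 0 = 0" "0 \<le> t \<Longrightarrow> stretch t 1 = 1"
  by (simp_all add: stretch_def)

lemma continuous_map_cube_coordinate:
  assumes "i < n"
  shows "continuous_map (unit_cube n) euclideanreal (\<lambda>x. x i)"
  using continuous_map_product_projection[of i "{..<n}" "\<lambda>_. top_of_set {0..1::real}"] assms
  by (auto simp: unit_cube_def continuous_map_in_subtopology)

lemma continuous_map_cube_stretch:
  "continuous_map (prod_topology (top_of_set {0..1}) (unit_cube n)) (unit_cube n)
     (\<lambda>(t, x). cube_stretch n t x)"
proof -
  let ?Z = "prod_topology (top_of_set {0..1::real}) (unit_cube n)"
  have "continuous_map ?Z (top_of_set {0..1}) (\<lambda>z. stretch (fst z) (snd z i))" if "i < n" for i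
  proof -
    have t: "continuous_map ?Z euclideanreal fst"
      using continuous_map_fst[of "top_of_set {0..1::real}" "unit_cube n"]
      by (simp add: continuous_map_in_subtopology)
    have x: "continuous_map ?Z euclideanreal (\<lambda>z. snd z i)"
      using continuous_map_compose[OF continuous_map_snd continuous_map_cube_coordinate[OF that]]
      by (simp add: o_def)
    have "continuous_map ?Z euclideanreal (\<lambda>z. stretch (fst z) (snd z i))"
      unfolding stretch_def
      by (intro continuous_map_real_max continuous_map_real_min continuous_map_add
          continuous_map_real_mult continuous_map_diff continuous_map_const[THEN iffD2] t x) auto
    then show ?thesis
      by (auto simp: continuous_map_in_subtopology stretch_def)
  qed
  then have "continuous_map ?Z (product_topology (\<lambda>_. top_of_set {0..1}) {..<n})
      (\<lambda>z. cube_stretch n (fst z) (snd z))"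
    unfolding continuous_map_componentwise by (auto simp: cube_stretch_def)
  then show ?thesis by (simp add: unit_cube_def case_prod_unfold)
qed

text \<open>A coordinate at an endpoint is fixed by \<open>stretch t\<close>. This keeps the
  squeezing homotopy equal to \<open>d\<close> on the boundary at all times.\<close>

lemma cube_stretch_boundary:
  assumes "x \<in> cube_boundary n" "0 \<le> t" "t \<le> 1"
  shows "cube_stretch n t x \<in> cube_boundary n"
proof -
  obtain i where i: "i < n" "x i = 0 \<or> x i = 1" and x: "x \<in> topspace (unit_cube n)"
    using assms(1) by (auto simp: cube_boundary_def)
  have "cube_stretch n t x \<in> topspace (unit_cube n)"
    using continuous_map_image_subset_topspace[OF continuous_map_cube_stretch[of n]] x assms(2,3)
    by force
  moreover have "cube_stretch n t x i = 0 \<or> cube_stretch n t x i = 1"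
    using i assms(2) by (auto simp: cube_stretch_def stretch_endpoints)
  ultimately show ?thesis using i(1) by (auto simp: cube_boundary_def)
qed

text \<open>The unclamped value of \<open>stretch 1 u\<close> is \<open>3 * u - 1\<close>, which
  reaches 0 and 1 at the two thresholds. The strict inequalities make the collar open; for
  \<open>n = 0\<close> it is empty.\<close>

definition cube_collar :: "nat \<Rightarrow> (nat \<Rightarrow> real) set" where
  "cube_collar n = {x \<in> topspace (unit_cube n). \<exists>i<n. x i < 1/3 \<or> 2/3 < x i}"

lemma openin_cube_collar: "openin (unit_cube n) (cube_collar n)"
proof -
  have "cube_collar n = (\<Union>i<n. {x \<in> topspace (unit_cube n). x i \<in> {..<1/3} \<union> {2/3<..}})"
    by (auto simp: cube_collar_def)
  moreover have "openin (unit_cube n) {x \<in> topspace (unit_cube n). x i \<in> {..<1/3} \<union> {2/3<..}}"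
    if "i < n" for i
    by (rule openin_continuous_map_preimage[OF continuous_map_cube_coordinate[OF that]])
      (auto simp: open_Un)
  ultimately show ?thesis by auto
qed

lemma boundary_subset_collar: "cube_boundary n \<subseteq> cube_collar n"
  by (force simp: cube_boundary_def cube_collar_def)

text \<open>A coordinate in an outer third is clamped to 0 or 1 at time 1. Hence a squeezed closed
  path is \<open>d\<close> on the whole collar.\<close>

lemma cube_stretch_collar:
  assumes "x \<in> cube_collar n"
  shows "cube_stretch n 1 x \<in> cube_boundary n"
proof -
  obtain i where i: "i < n" "x i < 1/3 \<or> 2/3 < x i" and x: "x \<in> topspace (unit_cube n)"
    using assms by (auto simp: cube_collar_def)
  have "cube_stretch n 1 x \<in> topspace (unit_cube n)"
    using continuous_map_image_subset_topspace[OF continuous_map_cube_stretch[of n]] x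
    by force
  moreover have "cube_stretch n 1 x i = 0 \<or> cube_stretch n 1 x i = 1"
    using i by (auto simp: cube_stretch_def stretch_def)
  ultimately show ?thesis using i(1) by (auto simp: cube_boundary_def)
qed

lemma homotopic_with_cube_stretch:
  assumes "p \<in> closed_paths n X d"
  shows "homotopic_with (\<lambda>h. \<forall>x\<in>cube_boundary n. h x = d) (unit_cube n) X
           p (\<lambda>x. p (cube_stretch n 1 x))"
proof -
  have p: "continuous_map (unit_cube n) X p" "\<And>x. x \<in> cube_boundary n \<Longrightarrow> p x = d"
    using assms by (auto simp: closed_paths_def)
  have stretch_id: "cube_stretch n 0 x = x" if "x \<in> topspace (unit_cube n)" for x
    using that by (auto simp: unit_cube_def cube_stretch_def PiE_iff stretch_0 fun_eq_iff
        extensional_def restrict_def)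
  let ?h = "\<lambda>z. p (cube_stretch n (fst z) (snd z))"
  \<comment> \<open>\<open>cube_stretch n 0\<close> is the identity only on the cube, so the ends of
    the homotopy are compared there only. The rule \<open>homotopic_with\<close> allows this once
    the predicate is known to ignore values off the cube.\<close>
  have cong: "(\<forall>x\<in>cube_boundary n. h x = d) = (\<forall>x\<in>cube_boundary n. k x = d)"
    if hk: "\<And>x. x \<in> topspace (unit_cube n) \<Longrightarrow> h x = k x" for h k :: "(nat \<Rightarrow> real) \<Rightarrow> 'a"
    using hk[OF subsetD[OF cube_boundary_subset]] by simp
  have "continuous_map (prod_topology (top_of_set {0..1}) (unit_cube n)) X ?h"
    using continuous_map_compose[OF continuous_map_cube_stretch p(1)]
    by (simp add: o_def case_prod_unfold)
  moreover have "\<forall>x\<in>topspace (unit_cube n). ?h (0, x) = p x"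
    by (simp add: stretch_id)
  moreover have "\<forall>t\<in>{0..1}. \<forall>x\<in>cube_boundary n. ?h (t, x) = d"
    by (simp add: p(2) cube_stretch_boundary)
  ultimately have "\<exists>h. continuous_map (prod_topology (top_of_set {0..1::real}) (unit_cube n)) X h \<and>
      (\<forall>x\<in>topspace (unit_cube n). h (0, x) = p x) \<and>
      (\<forall>x\<in>topspace (unit_cube n). h (1, x) = p (cube_stretch n 1 x)) \<and>
      (\<forall>t\<in>{0..1}. \<forall>x\<in>cube_boundary n. h (t, x) = d)"
    by (intro exI[of _ ?h]) simp
  then show ?thesis
    by (subst homotopic_with[where P = "\<lambda>h. \<forall>x\<in>cube_boundary n. h x = d", OF cong])
qed

lemma closed_path_homotopic_const:
  assumes D: "cpo D r" "d \<in> D" and p: "p \<in> closed_paths n (scott_topology D r) d"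
  shows "(p, const_path n d) \<in> path_homotopy n (scott_topology D r) d"
proof -
  let ?S = "scott_topology D r" and ?Q = "unit_cube n"
  let ?hom = "homotopic_with (\<lambda>h. \<forall>x\<in>cube_boundary n. h x = d) ?Q ?S"
  obtain b where b: "b \<in> D" "\<And>x. x \<in> D \<Longrightarrow> (b, x) \<in> r"
    using D(1) by (auto simp: cpo_def)
  have r: "(x, x) \<in> r" if "x \<in> D" for x
    using D(1) that by (auto simp: cpo_def partial_order_on_def preorder_on_def refl_on_def)
  \<comment> \<open>For \<open>n = 0\<close> this is the constant \<open>b\<close>, so a point is
    joined to \<open>d\<close> through the least element.\<close>
  define q where "q = (\<lambda>x. if x \<in> cube_collar n then d else b)"
  have q: "continuous_map ?Q ?S q"
    unfolding continuous_map_def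
  proof (intro conjI allI impI)
    show "q \<in> topspace ?Q \<rightarrow> topspace ?S" using D(2) b(1) by (auto simp: q_def)
  next
    fix U assume U: "openin ?S U"
    \<comment> \<open>Since \<open>U\<close> is final, no preimage under \<open>q\<close> can be the
      complement of the collar alone; continuity then only needs the collar to be open.\<close>
    then have "b \<in> U \<Longrightarrow> d \<in> U" using b D(2) by (auto simp: scott_open_def)
    then have "{x \<in> topspace ?Q. q x \<in> U} =
        (if b \<in> U then topspace ?Q else if d \<in> U then cube_collar n else {})"
      by (auto simp: q_def cube_collar_def)
    then show "openin ?Q {x \<in> topspace ?Q. q x \<in> U}"
      by (simp add: openin_cube_collar)
  qed
  have q_bd: "\<forall>x\<in>cube_boundary n. q x = d"
    using boundary_subset_collar by (auto simp: q_def)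
  have c: "const_path n d \<in> closed_paths n ?S d"
    using D(2) by (simp add: const_path_in_closed_paths)
  let ?p = "\<lambda>x. p (cube_stretch n 1 x)"
  have p_hom: "?hom p ?p" by (rule homotopic_with_cube_stretch[OF p])
  have p_cont: "continuous_map ?Q ?S ?p"
    using homotopic_with_imp_continuous_maps[OF p_hom] by simp
  have p_bd: "\<forall>x\<in>cube_boundary n. ?p x = d"
    using homotopic_with_imp_property[OF p_hom] by simp
  have le_p: "(q x, ?p x) \<in> r" if "x \<in> topspace ?Q" for x
  proof (cases "x \<in> cube_collar n")
    \<comment> \<open>Here both maps take the value \<open>d\<close>; off the collar
      \<open>q\<close> is the least element \<open>b\<close>.\<close>
    case True
    then show ?thesis using p cube_stretch_collar[OF True] r[OF D(2)]
      by (simp add: q_def closed_paths_def)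
  next
    case False
    then show ?thesis using p_cont that b(2) by (auto simp: q_def continuous_map_def Pi_iff)
  qed
  have q_p: "?hom q ?p"
  proof (rule homotopic_with_scott_le)
    show "(q x, ?p x) \<in> r" if "x \<in> topspace ?Q" for x using that by (rule le_p)
  qed (simp_all add: q p_cont q_bd p_bd)
  have q_c: "?hom q (const_path n d)"
  proof (rule homotopic_with_scott_le)
    show "(q x, const_path n d x) \<in> r" if "x \<in> topspace ?Q" for x
      using that D(2) b(2) r by (simp add: q_def const_path_def)
  qed (use c q q_bd in \<open>simp_all add: closed_paths_def\<close>)
  have "?hom p (const_path n d)"
    by (rule homotopic_with_trans[OF p_hom homotopic_with_trans[OF homotopic_with_symD[OF q_p] q_c]])
  then show ?thesis using p c by (simp add: path_homotopy_def)
qed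

theorem theorem4p1:
  fixes D :: "'a set" and r :: "'a rel" and d :: 'a and n :: nat
  assumes "cpo D r" and "d \<in> D"
  shows "homotopy_classes n (scott_topology D r) d
       = {homotopy_class n (scott_topology D r) d (const_path n d)}"
proof -
  let ?C = "closed_paths n (scott_topology D r) d" and ?R = "path_homotopy n (scott_topology D r) d"
  \<comment> \<open>This makes the quotient nonempty; the next step shows that all its classes
    coincide.\<close>
  have "const_path n d \<in> ?C"
    using assms(2) by (simp add: const_path_in_closed_paths)
  moreover have "?R `` {p} = ?R `` {const_path n d}" if "p \<in> ?C" for p
    using equiv_class_eq[OF equiv_path_homotopy closed_path_homotopic_const[OF assms that]] .
  ultimately show ?thesis
    unfolding homotopy_classes_def homotopy_class_def quotient_def by blast
qed

end
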